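(* Every interval graph is a $\Delta$-disk graph. Moreover, there exists a $\Delta$-disk graph that is not an interval graph.
   Context: An interval graph is the intersection graph of a finite family of intervals of the real line. A $\Delta$-disk graph is a graph having a representation as the intersection graph of closed disks $D_v$ with centers $(x_v,y_v)$ and radii $r_v$ ($v\in V(G)$) such that for every $v$, $x_v>0$, $y_v>0$ and $\max(x_v,y_v)\leq r_v<\sqrt{x_v^2+y_v^2}$. *)

theory Defs
  imports "HOL-Analysis.Analysis" "Graph_Theory.Pair_Digraph"
begin

text \<open>
  Finite simple undirected graphs are the \<^const>\<open>pair_graph\<close>s of Graph_Theory: finite, loop-free,
  with a symmetric set of arcs, so that the edge \<open>uv\<close> is present as both \<open>(u, v)\<close> and \<open>(v, u)\<close>.
  Distinct vertices may be represented by the same set.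
\<close>

definition intersection_graph_of :: "('a \<Rightarrow> 'b set) \<Rightarrow> 'a pair_pre_digraph \<Rightarrow> bool" where
  "intersection_graph_of S G \<longleftrightarrow> pair_graph G \<and>
     (\<forall>u\<in>pverts G. \<forall>v\<in>pverts G. u \<noteq> v \<longrightarrow> ((u, v) \<in> parcs G \<longleftrightarrow> S u \<inter> S v \<noteq> {}))"

text \<open>
  Intervals are nonempty but otherwise arbitrary: open, closed or half-open, bounded or not,
  possibly a single point.
\<close>

definition interval_graph :: "'a pair_pre_digraph \<Rightarrow> bool" where
  "interval_graph G \<longleftrightarrow>
     (\<exists>I :: 'a \<Rightarrow> real set.
        (\<forall>v\<in>pverts G. is_interval (I v) \<and> I v \<noteq> {}) \<and> intersection_graph_of I G)"

text \<open>The metric on \<^typ>\<open>real \<times> real\<close> is the Euclidean one, so \<^const>\<open>cball\<close> is a closed disk.\<close>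

definition Delta_disk_graph :: "'a pair_pre_digraph \<Rightarrow> bool" where
  "Delta_disk_graph G \<longleftrightarrow>
     (\<exists>(x :: 'a \<Rightarrow> real) (y :: 'a \<Rightarrow> real) (r :: 'a \<Rightarrow> real).
        (\<forall>v\<in>pverts G. x v > 0 \<and> y v > 0 \<and>
           max (x v) (y v) \<le> r v \<and> r v < sqrt ((x v)\<^sup>2 + (y v)\<^sup>2)) \<and>
        intersection_graph_of (\<lambda>v. cball (x v, y v) (r v)) G)"

end

theory Submission
  imports Defs
begin

text \<open>
  A disk centred on the diagonal is determined by the interval \<open>[l, h]\<close> of distances from the
  origin at which it meets the diagonal, and two such disks meet iff their intervals do. The
  radius condition on the disk says \<open>0 < l\<close> and \<open>(3 + 2 \<surd>2) l \<le> h\<close>. The intervals of an interval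
  graph can be taken compact; replacing \<open>[a, b]\<close> by \<open>[exp (t a), 6 exp (t b)]\<close> preserves their
  intersection pattern for large \<open>t\<close> and achieves this condition. The separating example is the
  4-cycle.
\<close>

text \<open>Shrink each \<open>I v\<close> to the hull of finitely many points, one chosen in every
  nonempty \<open>I u \<inter> I v\<close>. A hull inside \<open>I v\<close> creates no new
  intersection, and the chosen common points keep the old ones.\<close>

lemma compact_interval_representation:
  assumes "interval_graph G"
  obtains a b :: "'a \<Rightarrow> real"
  where "\<And>v. v \<in> pverts G \<Longrightarrow> a v \<le> b v"
    and "intersection_graph_of (\<lambda>v. {a v..b v}) G"
proof -
  from assms obtain I :: "'a \<Rightarrow> real set"
    where I: "\<And>v. v \<in> pverts G \<Longrightarrow> is_interval (I v) \<and> I v \<noteq> {}"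
      and ig: "intersection_graph_of I G"
    unfolding interval_graph_def by blast
  then interpret pair_graph G unfolding intersection_graph_of_def by blast
  define p where "p u v = (SOME z. z \<in> I u \<inter> I v)" for u v
  \<comment> \<open>\<open>N v\<close> contains \<open>v\<close> itself, so even an isolated vertex
    has a point to take the hull of.\<close>
  define N where "N v = {u \<in> pverts G. I u \<inter> I v \<noteq> {}}" for v
  define a where "a v = Min (p v ` N v)" for v
  define b where "b v = Max (p v ` N v)" for v
  have p_in: "p u v \<in> I u \<inter> I v" if "I u \<inter> I v \<noteq> {}" for u v
    using that unfolding p_def by (metis all_not_in_conv someI_ex)
  \<comment> \<open>The choice depends only on the set \<open>I u \<inter> I v\<close>, so both
    hulls receive the same point.\<close>
  have p_commute: "p u v = p v u" for u v
    unfolding p_def by (simp add: Int_commute)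
  have fin: "finite (p v ` N v)" for v
    unfolding N_def by simp
  have ne: "p v ` N v \<noteq> {}" if "v \<in> pverts G" for v
    using that I[OF that] unfolding N_def by auto
  have p_le: "a v \<le> p v u \<and> p v u \<le> b v" if "u \<in> N v" for u v
    using that fin unfolding a_def b_def by simp
  have le: "a v \<le> b v" if "v \<in> pverts G" for v
    using ne[OF that] p_le by fastforce
  have sub: "{a v..b v} \<subseteq> I v" if v: "v \<in> pverts G" for v
  proof -
    have "p v ` N v \<subseteq> I v"
      using p_in by (auto simp: N_def Int_commute)
    then have "a v \<in> I v" "b v \<in> I v"
      unfolding a_def b_def using Min_in[OF fin ne[OF v]] Max_in[OF fin ne[OF v]] by auto
    then show ?thesis
      using I[OF v] by (auto intro: mem_is_interval_1_I)
  qed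
  have "(u, v) \<in> parcs G \<longleftrightarrow> {a u..b u} \<inter> {a v..b v} \<noteq> {}"
    if u: "u \<in> pverts G" and v: "v \<in> pverts G" and "u \<noteq> v" for u v
  proof -
    have arc: "(u, v) \<in> parcs G \<longleftrightarrow> I u \<inter> I v \<noteq> {}"
      using ig that unfolding intersection_graph_of_def by blast
    moreover have "p u v \<in> {a u..b u} \<inter> {a v..b v}" if "I u \<inter> I v \<noteq> {}"
      using p_le[of v u] p_le[of u v] that u v p_commute[of u v]
      unfolding N_def by (auto simp: Int_commute)
    ultimately show ?thesis
      using sub[OF u] sub[OF v] by blast
  qed
  then have "intersection_graph_of (\<lambda>v. {a v..b v}) G"
    using ig unfolding intersection_graph_of_def by blast
  with le show ?thesis by (rule that)
qed

lemma cball_Int_cball_nonempty_iff: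
  fixes c d :: "'a::real_normed_vector"
  assumes "0 \<le> r" "0 \<le> s"
  shows "cball c r \<inter> cball d s \<noteq> {} \<longleftrightarrow> dist c d \<le> r + s"
proof
  show "dist c d \<le> r + s" if "cball c r \<inter> cball d s \<noteq> {}"
    using that disjoint_cballI[of r s c d] by force
next
  assume le: "dist c d \<le> r + s"
  show "cball c r \<inter> cball d s \<noteq> {}"
  proof (cases "r + s = 0")
    case True
    then have "r = 0" "s = 0" "c = d" using assms le by auto
    then show ?thesis by simp
  next
    case False
    then have pos: "r + s > 0" using assms by linarith
    \<comment> \<open>\<open>z\<close> divides the segment from \<open>c\<close> to \<open>d\<close>
      in the ratio \<open>r : s\<close>.\<close>
    define z where "z = c + (r / (r + s)) *\<^sub>R (d - c)"
    have dz: "d - z = (s / (r + s)) *\<^sub>R (d - c)"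
    proof -
      have s: "s / (r + s) = 1 - r / (r + s)" using pos by (simp add: field_simps)
      show ?thesis unfolding z_def s scaleR_diff_left by simp
    qed
    have "dist c z = r * (dist c d / (r + s))" "dist d z = s * (dist c d / (r + s))"
      using assms pos dz by (simp_all add: z_def dist_norm norm_minus_commute)
    moreover have "dist c d / (r + s) \<le> 1" using le pos by simp
    ultimately have "z \<in> cball c r \<inter> cball d s"
      using assms by (simp only: Int_iff mem_cball mult_left_le)
    then show ?thesis by blast
  qed
qed

text \<open>The centre has signed distance \<open>(l + h) / 2\<close> from the origin along the
  diagonal, so the distance of two centres is that of the midpoints of \<open>[l, h]\<close> and
  \<open>[l', h']\<close>, and the question becomes one-dimensional.\<close>

lemma diagonal_disks_meet_iff:
  fixes l h l' h' :: real
  assumes "l \<le> h" "l' \<le> h'"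
  shows "cball ((l + h) / (2 * sqrt 2), (l + h) / (2 * sqrt 2)) ((h - l) / 2) \<inter>
      cball ((l' + h') / (2 * sqrt 2), (l' + h') / (2 * sqrt 2)) ((h' - l') / 2) \<noteq> {}
    \<longleftrightarrow> l \<le> h' \<and> l' \<le> h"
proof -
  let ?c = "(l + h) / (2 * sqrt 2)" and ?d = "(l' + h') / (2 * sqrt 2)"
  have "dist (?c, ?c) (?d, ?d) = sqrt (2 * (?c - ?d)\<^sup>2)"
    by (simp add: dist_Pair_Pair dist_real_def)
  also have "?c - ?d = (l + h - l' - h') / (2 * sqrt 2)"
    by (simp only: diff_divide_distrib add_divide_distrib)
  also have "2 * \<dots>\<^sup>2 = ((l + h - l' - h') / 2)\<^sup>2"
    by (simp add: power_divide power_mult_distrib)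
  finally have "dist (?c, ?c) (?d, ?d) = \<bar>(l + h - l' - h') / 2\<bar>"
    by (simp only: real_sqrt_abs)
  moreover have "\<bar>(l + h - l' - h') / 2\<bar> \<le> (h - l) / 2 + (h' - l') / 2 \<longleftrightarrow> l \<le> h' \<and> l' \<le> h"
    by argo
  moreover have "0 \<le> (h - l) / 2" "0 \<le> (h' - l') / 2" using assms by simp_all
  ultimately show ?thesis by (simp only: cball_Int_cball_nonempty_iff)
qed

lemma diagonal_disk_Delta:
  fixes l h :: real
  assumes "0 < l" "6 * l \<le> h"
  defines "c \<equiv> (l + h) / (2 * sqrt 2)"
  shows "0 < c" "c \<le> (h - l) / 2" "(h - l) / 2 < sqrt (c\<^sup>2 + c\<^sup>2)"
proof -
  show "0 < c" using assms by simp
  \<comment> \<open>The bound 7/5 matches the factor 6: \<open>l + h \<le> 7 / 5 * (h - l)\<close>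
    is equivalent to \<open>6 * l \<le> h\<close>.\<close>
  have "sqrt 2 \<ge> (7 / 5 :: real)"
    by (rule real_le_rsqrt) (simp add: power2_eq_square)
  then have "7 / 5 * (h - l) \<le> sqrt 2 * (h - l)"
    using assms by (intro mult_right_mono) auto
  then have "l + h \<le> sqrt 2 * (h - l)" using assms by simp
  then show "c \<le> (h - l) / 2"
    unfolding c_def by (simp add: field_simps)
  have "c\<^sup>2 + c\<^sup>2 = ((l + h) / 2)\<^sup>2"
    unfolding c_def by (simp add: power_divide power_mult_distrib)
  then have "sqrt (c\<^sup>2 + c\<^sup>2) = (l + h) / 2"
    using assms by simp
  then show "(h - l) / 2 < sqrt (c\<^sup>2 + c\<^sup>2)" using assms by simp
qed

text \<open>For a single pair with a positive gap, \<open>exp (t * (a v - b u))\<close> tends to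
  infinity and eventually exceeds \<open>K\<close>; finitely many pairs share a common
  \<open>t\<close>.\<close>

lemma exists_separating_scale:
  fixes a b :: "'a \<Rightarrow> real" and K :: real
  assumes "finite V"
  obtains t where "0 < t"
    and "\<And>u v. u \<in> V \<Longrightarrow> v \<in> V \<Longrightarrow> b u < a v \<Longrightarrow> K * exp (t * b u) < exp (t * a v)"
proof -
  have "\<forall>\<^sub>F t in at_top. K * exp (t * b u) < exp (t * a v)" if "b u < a v" for u v
  proof -
    have "filterlim (\<lambda>t. exp (t * (a v - b u))) at_top at_top"
      using that by (intro filterlim_compose[OF exp_at_top]
          filterlim_at_top_mult_tendsto_pos[OF tendsto_const] filterlim_ident) auto
    then have "\<forall>\<^sub>F t in at_top. K < exp (t * (a v - b u))"
      by (simp add: filterlim_at_top_dense)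
    then show ?thesis
      by eventually_elim (simp add: right_diff_distrib exp_diff field_simps)
  qed
  then have "\<forall>\<^sub>F t in at_top. \<forall>u\<in>V. \<forall>v\<in>V. b u < a v \<longrightarrow> K * exp (t * b u) < exp (t * a v)"
    using assms by (simp add: eventually_ball_finite_distrib)
  then have "\<forall>\<^sub>F t in at_top.
      0 < t \<and> (\<forall>u\<in>V. \<forall>v\<in>V. b u < a v \<longrightarrow> K * exp (t * b u) < exp (t * a v))"
    using eventually_gt_at_top by (rule eventually_conj[rotated])
  then obtain t where "0 < t"
      "\<forall>u\<in>V. \<forall>v\<in>V. b u < a v \<longrightarrow> K * exp (t * b u) < exp (t * a v)"
    using eventually_happens'[OF trivial_limit_at_top_linorder] by blast
  with that show ?thesis by blast
qed

lemma interval_graph_imp_Delta_disk_graph: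
  assumes "interval_graph G"
  shows "Delta_disk_graph G"
proof -
  obtain a b where ab: "\<And>v. v \<in> pverts G \<Longrightarrow> a v \<le> b v"
    and ig: "intersection_graph_of (\<lambda>v. {a v..b v :: real}) G"
    using compact_interval_representation[OF assms] by blast
  then interpret pair_graph G unfolding intersection_graph_of_def by blast
  obtain t where t: "0 < t"
    and sep: "\<And>u v. u \<in> pverts G \<Longrightarrow> v \<in> pverts G \<Longrightarrow> b u < a v
      \<Longrightarrow> 6 * exp (t * b u) < exp (t * a v)"
    using exists_separating_scale[of "pverts G" b a 6] by auto
  define l h where "l v = exp (t * a v)" and "h v = 6 * exp (t * b v)" for v
  define c where "c v = (l v + h v) / (2 * sqrt 2)" for v
  have lh: "0 < l v" "6 * l v \<le> h v" if "v \<in> pverts G" for v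
    using ab[OF that] t unfolding l_def h_def by auto
  \<comment> \<open>If \<open>a u \<le> b v\<close>, the factor 6 only enlarges the right side; if
    \<open>b v < a u\<close>, the choice of \<open>t\<close> outweighs it.\<close>
  have endpoint_order: "l u \<le> h v \<longleftrightarrow> a u \<le> b v" if "u \<in> pverts G" "v \<in> pverts G" for u v
  proof
    show "a u \<le> b v" if "l u \<le> h v"
      using sep[of v u] that \<open>u \<in> pverts G\<close> \<open>v \<in> pverts G\<close> unfolding l_def h_def by force
  next
    assume "a u \<le> b v"
    then have "exp (t * a u) \<le> exp (t * b v)" using t by simp
    then show "l u \<le> h v" unfolding l_def h_def using exp_gt_zero[of "t * b v"] by linarith
  qed
  have "cball (c u, c u) ((h u - l u) / 2) \<inter> cball (c v, c v) ((h v - l v) / 2) \<noteq> {}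
      \<longleftrightarrow> {a u..b u} \<inter> {a v..b v} \<noteq> {}"
    if u: "u \<in> pverts G" and v: "v \<in> pverts G" for u v
  proof -
    have "l u \<le> h u" "l v \<le> h v" using lh[OF u] lh[OF v] by auto
    then show ?thesis
      unfolding c_def using ab[OF u] ab[OF v] endpoint_order[OF u v] endpoint_order[OF v u]
      by (subst diagonal_disks_meet_iff) auto
  qed
  then have "intersection_graph_of (\<lambda>v. cball (c v, c v) ((h v - l v) / 2)) G"
    using ig unfolding intersection_graph_of_def by simp
  moreover have "c v > 0 \<and> c v > 0 \<and> max (c v) (c v) \<le> (h v - l v) / 2 \<and>
      (h v - l v) / 2 < sqrt ((c v)\<^sup>2 + (c v)\<^sup>2)" if "v \<in> pverts G" for v
    using diagonal_disk_Delta[OF lh[OF that]] unfolding c_def by simp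
  ultimately show ?thesis
    unfolding Delta_disk_graph_def
    by (intro exI[of _ c] exI[of _ "\<lambda>v. (h v - l v) / 2"]) simp
qed

definition four_cycle :: "nat pair_pre_digraph" where
  "four_cycle = \<lparr>pverts = {0, 1, 2, 3},
     parcs = {(0, 1), (1, 0), (1, 2), (2, 1), (2, 3), (3, 2), (3, 0), (0, 3)}\<rparr>"

lemma pair_graph_four_cycle: "pair_graph four_cycle"
  by unfold_locales (auto simp: four_cycle_def symmetric_def arcs_ends_def arc_to_ends_def sym_def)

lemma disjoint_intervals_ordered:
  fixes A B :: "real set"
  assumes "is_interval A" "is_interval B" "A \<inter> B = {}"
  shows "(\<forall>x\<in>A. \<forall>y\<in>B. x < y) \<or> (\<forall>x\<in>A. \<forall>y\<in>B. y < x)"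
proof (rule ccontr)
  assume "\<not> ?thesis"
  then obtain x y x' y' where xy: "x \<in> A" "y \<in> B" "y \<le> x" "x' \<in> A" "y' \<in> B" "x' \<le> y'"
    by (meson not_le)
  show False
  \<comment> \<open>The larger of \<open>y\<close> and \<open>x'\<close> falls in both sets: either
    \<open>x'\<close> lies between \<open>y\<close> and \<open>y'\<close>, or \<open>y\<close> lies
    between \<open>x'\<close> and \<open>x\<close>.\<close>
  proof (cases "y \<le> x'")
    case True
    then have "x' \<in> B" using mem_is_interval_1_I[OF assms(2), of y y' x'] xy by simp
    then show False using xy assms(3) by blast
  next
    case False
    then have "y \<in> A" using mem_is_interval_1_I[OF assms(1), of x' x y] xy by simp
    then show False using xy assms(3) by blast
  qed
qed

lemma four_cycle_not_interval_graph: "\<not> interval_graph four_cycle"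
proof
  assume "interval_graph four_cycle"
  then obtain I :: "nat \<Rightarrow> real set"
    where I: "\<And>v. v \<in> pverts four_cycle \<Longrightarrow> is_interval (I v)"
      and ig: "intersection_graph_of I four_cycle"
    unfolding interval_graph_def by blast
  have edges: "I 0 \<inter> I 1 \<noteq> {}" "I 1 \<inter> I 2 \<noteq> {}" "I 2 \<inter> I 3 \<noteq> {}" "I 3 \<inter> I 0 \<noteq> {}"
    and non_edges: "I 0 \<inter> I 2 = {}" "I 1 \<inter> I 3 = {}"
    using ig unfolding intersection_graph_of_def four_cycle_def by simp_all
  obtain p q r s where pqrs: "p \<in> I 0" "p \<in> I 1" "q \<in> I 1" "q \<in> I 2"
      "r \<in> I 2" "r \<in> I 3" "s \<in> I 3" "s \<in> I 0"
    using edges by blast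
  have "is_interval (I v)" if "v \<in> {0, 1, 2, 3}" for v
    using I that by (simp add: four_cycle_def)
  then have "(\<forall>x\<in>I 0. \<forall>y\<in>I 2. x < y) \<or> (\<forall>x\<in>I 0. \<forall>y\<in>I 2. y < x)"
      "(\<forall>x\<in>I 1. \<forall>y\<in>I 3. x < y) \<or> (\<forall>x\<in>I 1. \<forall>y\<in>I 3. y < x)"
    using non_edges by (intro disjoint_intervals_ordered; simp)+
  \<comment> \<open>The pair 0, 2 separates \<open>p\<close>, \<open>s\<close> from
    \<open>q\<close>, \<open>r\<close>, while the pair 1, 3 separates \<open>p\<close>,
    \<open>q\<close> from \<open>r\<close>, \<open>s\<close>. Once the order of \<open>p\<close> and
    \<open>r\<close> is fixed, the two separations order \<open>q\<close> and \<open>s\<close>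
    oppositely.\<close>
  then have "p < r \<and> s < q \<or> r < p \<and> q < s" "p < r \<and> q < s \<or> r < p \<and> s < q"
    using pqrs by blast+
  then show False by linarith
qed

text \<open>
  All four disks are tangent to an axis, and the reflection in the diagonal swaps \<open>0\<close> with \<open>1\<close>
  and \<open>2\<close> with \<open>3\<close>. The disks \<open>2\<close> and \<open>3\<close> are so large that they look like half-planes at the
  scale of the other two; \<open>(p, q) = (21, 55)\<close> solves \<open>(p - 2)\<^sup>2 > 6 q + 3\<close> (disks \<open>0\<close> and \<open>2\<close> are
  disjoint) and \<open>(p - 1)\<^sup>2 \<le> 8 q\<close> (disks \<open>0\<close> and \<open>3\<close> meet).
\<close>

lemma Delta_disk_graph_four_cycle: "Delta_disk_graph four_cycle"
proof -
  define x :: "nat \<Rightarrow> real" where "x = (\<lambda>_. 0)(0 := 2, 1 := 1, 2 := 21, 3 := 55)"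
  define y :: "nat \<Rightarrow> real" where "y = (\<lambda>_. 0)(0 := 1, 1 := 2, 2 := 55, 3 := 21)"
  define r :: "nat \<Rightarrow> real" where "r = (\<lambda>_. 0)(0 := 2, 1 := 2, 2 := 55, 3 := 55)"
  \<comment> \<open>Squaring removes the root, so each adjacency test becomes integer
    arithmetic.\<close>
  have meet_iff: "cball (x u, y u) (r u) \<inter> cball (x v, y v) (r v) \<noteq> {} \<longleftrightarrow>
      (x u - x v)\<^sup>2 + (y u - y v)\<^sup>2 \<le> (r u + r v)\<^sup>2" for u v
  proof -
    have r: "0 \<le> r u" "0 \<le> r v" unfolding r_def by auto
    have "dist (x u, y u) (x v, y v) = sqrt ((x u - x v)\<^sup>2 + (y u - y v)\<^sup>2)"
      by (simp add: dist_Pair_Pair dist_real_def)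
    then show ?thesis
      using r real_sqrt_le_iff[of _ "(r u + r v)\<^sup>2"]
      by (simp only: cball_Int_cball_nonempty_iff[OF r]) simp
  qed
  have "intersection_graph_of (\<lambda>v. cball (x v, y v) (r v)) four_cycle"
    unfolding intersection_graph_of_def meet_iff
    using pair_graph_four_cycle by (simp add: four_cycle_def x_def y_def r_def)
  moreover have "\<forall>v\<in>pverts four_cycle. x v > 0 \<and> y v > 0 \<and>
      max (x v) (y v) \<le> r v \<and> r v < sqrt ((x v)\<^sup>2 + (y v)\<^sup>2)"
    by (auto simp: four_cycle_def x_def y_def r_def intro!: real_less_rsqrt)
  ultimately show ?thesis
    unfolding Delta_disk_graph_def by blast
qed

theorem theorem18:
  shows "(\<forall>G :: 'a pair_pre_digraph. interval_graph G \<longrightarrow> Delta_disk_graph G) \<and>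
         (\<exists>G :: nat pair_pre_digraph. Delta_disk_graph G \<and> \<not> interval_graph G)"
  using interval_graph_imp_Delta_disk_graph Delta_disk_graph_four_cycle
    four_cycle_not_interval_graph by blast

end
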